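(* Let $G$ be a topological group with unit $e$. The following are equivalent: (1) $G$ is totally bounded; (2) $G$ satisfies $\mathsf{S}_{\mathrm{cof}}(\Omega(e),\Gamma)$.
   Context: A cover of a set $X$ is a family $\mathcal{U}$ of subsets of $X$ with $X\notin\mathcal{U}$ and $X=\bigcup\mathcal{U}$. A cover $\mathcal{U}$ of $X$ is a $\gamma$-cover if $\mathcal{U}$ is infinite and each $x\in X$ belongs to all but finitely many $U\in\mathcal{U}$. $\Gamma$ denotes the family of all $\gamma$-covers of $G$ consisting of open sets. A set $U\subseteq G$ is finitely-bounding if there is a finite $F\subseteq G$ such that $F\cdot U=G$. $G$ is totally bounded if every open neighborhood of $e$ is finitely-bounding. For $U\subseteq G$, let $\omega(U)=\{F\cdot U : F\subseteq G \text{ finite}\}$. $\Omega(e)$ is the collection of all families $\omega(U)$ such that $U$ is an open neighborhood of $e$ which is not finitely-bounding. For collections $\mathscr{A},\mathscr{B}$, the property $\mathsf{S}_{\mathrm{cof}}(\mathscr{A},\mathscr{B})$ is: for each sequence $\{\mathcal{U}_n\}_{n\in\mathbb{N}}$ of members of $\mathscr{A}$, there exist cofinite subsets $\mathcal{V}_n\subseteq\mathcal{U}_n$, $n\in\mathbb{N}$ (i.e., $\mathcal{U}_n\setminus\mathcal{V}_n$ is finite), such that $\bigcup_{n\in\mathbb{N}}\mathcal{V}_n\in\mathscr{B}$. *)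

theory Defs
  imports "HOL-Analysis.Analysis" "HOL-Library.Set_Algebras"
begin

text \<open>
  The group \<open>G\<close> is the whole type \<open>'a\<close> of class \<open>topological_group_add\<close>: an arbitrary topological
  group, not assumed commutative or Hausdorff, written additively. So \<open>e\<close> is \<open>0\<close>, and \<open>F \<cdot> U\<close> is
  the elementwise sum \<open>F + U\<close> from \<open>Set_Algebras\<close>; the translating elements are on the left.
\<close>

definition is_cover :: "'x set \<Rightarrow> 'x set set \<Rightarrow> bool" where
  "is_cover X \<U> \<longleftrightarrow> X \<notin> \<U> \<and> X = \<Union>\<U>"

definition gamma_cover :: "'x set \<Rightarrow> 'x set set \<Rightarrow> bool" where
  "gamma_cover X \<U> \<longleftrightarrow> is_cover X \<U> \<and> infinite \<U> \<and> (\<forall>x\<in>X. finite {U \<in> \<U>. x \<notin> U})"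

definition open_gamma_covers :: "'x::topological_space set set set" where
  "open_gamma_covers = {\<U>. gamma_cover UNIV \<U> \<and> (\<forall>U\<in>\<U>. open U)}"

definition finitely_bounding :: "'a::group_add set \<Rightarrow> bool" where
  "finitely_bounding U \<longleftrightarrow> (\<exists>F. finite F \<and> F + U = UNIV)"

definition totally_bounded_group :: "'a::topological_group_add itself \<Rightarrow> bool" where
  "totally_bounded_group (_ :: 'a itself) \<longleftrightarrow>
     (\<forall>U :: 'a set. open U \<and> 0 \<in> U \<longrightarrow> finitely_bounding U)"

definition omega_family :: "'a::group_add set \<Rightarrow> 'a set set" where
  "omega_family U = {F + U | F. finite F}"

definition Omega_unit :: "'a::topological_group_add set set set" where
  "Omega_unit = {omega_family U | U. open U \<and> 0 \<in> U \<and> \<not> finitely_bounding U}"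

definition S_cof :: "'x set set \<Rightarrow> 'x set set \<Rightarrow> bool" where
  "S_cof \<A> \<B> \<longleftrightarrow>
     (\<forall>\<U> :: nat \<Rightarrow> 'x set. (\<forall>n. \<U> n \<in> \<A>) \<longrightarrow>
        (\<exists>\<V> :: nat \<Rightarrow> 'x set.
           (\<forall>n. \<V> n \<subseteq> \<U> n \<and> finite (\<U> n - \<V> n)) \<and> (\<Union>n. \<V> n) \<in> \<B>))"

end

theory Submission
  imports Defs
begin

text \<open>
  If the group is totally bounded, there are no families in \<^term>\<open>Omega_unit\<close>, so the selection
  property holds vacuously.

  Conversely, the selection property fails as soon as some open neighbourhood \<open>U\<close> of \<open>0\<close> is not
  finitely bounding, even for a constant sequence of families and because of the single point \<open>0\<close>.
  Intersecting \<open>U\<close> with its set of inverses makes it symmetric. If \<open>x \<notin> U\<close>, symmetry gives \<open>0 \<notin> x + U\<close>, while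
  \<open>x \<in> x + U\<close>. Hence the translates that miss \<open>0\<close>, together with \<open>U\<close>, cover the group, and so
  infinitely many of them are distinct (\<open>infinite_omega_family_missing_zero\<close>). Removing finitely
  many members of \<^term>\<open>omega_family U\<close> leaves infinitely many that miss \<open>0\<close>, which no
  \<open>\<gamma>\<close>-cover has.
\<close>

lemma finitely_bounding_mono:
  assumes "finitely_bounding U" "U \<subseteq> V"
  shows "finitely_bounding V"
proof -
  obtain F where "finite F" "F + U = UNIV"
    using assms(1) unfolding finitely_bounding_def by blast
  moreover have "F + U \<subseteq> F + V"
    using assms(2) by (intro set_plus_mono2 subset_refl)
  ultimately show ?thesis
    unfolding finitely_bounding_def by blast
qed

text \<open>
  Without symmetry the argument would cover only the complement of \<open>uminus ` U\<close> by finitely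
  many translates of \<open>U\<close>, leaving \<open>uminus ` U\<close> to be covered.
\<close>

lemma infinite_omega_family_missing_zero:
  fixes U :: "'a::group_add set"
  assumes zero: "0 \<in> U" and sym: "\<And>x. x \<in> U \<Longrightarrow> - x \<in> U"
    and not_bounding: "\<not> finitely_bounding U"
  shows "infinite {W \<in> omega_family U. 0 \<notin> W}"
proof
  assume "finite {W \<in> omega_family U. 0 \<notin> W}"
  moreover have "(\<lambda>x. {x} + U) ` (- U) \<subseteq> {W \<in> omega_family U. 0 \<notin> W}"
  proof clarify
    fix x assume "x \<notin> U"
    have "0 \<notin> {x} + U"
    proof
      assume "0 \<in> {x} + U"
      then obtain u where "u \<in> U" "0 = x + u"
        by (auto elim: set_plus_elim)
      then have "x = - u"
        by (simp add: eq_neg_iff_add_eq_0)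
      with \<open>u \<in> U\<close> \<open>x \<notin> U\<close> sym show False by blast
    qed
    then show "{x} + U \<in> omega_family U \<and> 0 \<notin> {x} + U"
      unfolding omega_family_def by blast
  qed
  ultimately have "finite ((\<lambda>x. {x} + U) ` (- U))"
    by (rule rev_finite_subset)
  then obtain F where F: "finite F" "(\<lambda>x. {x} + U) ` (- U) = (\<lambda>x. {x} + U) ` F"
    by (metis finite_subset_image subset_refl)
  have "x \<in> insert 0 F + U" for x
  proof (cases "x \<in> U")
    case True
    then show ?thesis
      using set_plus_intro[of 0 "insert 0 F" x U] by simp
  next
    case False
    then obtain f where "f \<in> F" "{x} + U = {f} + U"
      using F(2) by blast
    moreover have "{f} + U \<subseteq> insert 0 F + U"
      using \<open>f \<in> F\<close> by (intro set_plus_mono2) auto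
    moreover have "x \<in> {x} + U"
      using set_plus_intro[of x "{x}" 0 U] zero by simp
    ultimately show ?thesis
      by blast
  qed
  with F(1) not_bounding show False
    unfolding finitely_bounding_def by blast
qed

theorem theorem9:
  shows "totally_bounded_group TYPE('a::topological_group_add) \<longleftrightarrow>
         S_cof (Omega_unit :: 'a set set set) (open_gamma_covers :: 'a set set set)"
proof
  assume "totally_bounded_group TYPE('a)"
  then have "(Omega_unit :: 'a set set set) = {}"
    unfolding totally_bounded_group_def Omega_unit_def by blast
  then show "S_cof (Omega_unit :: 'a set set set) open_gamma_covers"
    unfolding S_cof_def by blast
next
  assume S: "S_cof (Omega_unit :: 'a set set set) (open_gamma_covers :: 'a set set set)"
  show "totally_bounded_group TYPE('a)"
    unfolding totally_bounded_group_def
  proof (intro allI impI, rule ccontr)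
    fix U :: "'a set"
    assume U: "open U \<and> 0 \<in> U" "\<not> finitely_bounding U"
    define V where "V = U \<inter> uminus -` U"
    have V: "open V" "0 \<in> V" "\<And>x. x \<in> V \<Longrightarrow> - x \<in> V"
      using U(1) unfolding V_def by (auto intro!: open_Int open_vimage continuous_intros)
    have "\<not> finitely_bounding V"
      using U(2) finitely_bounding_mono[of V U] unfolding V_def by blast
    then have "omega_family V \<in> Omega_unit"
      and inf: "infinite {W \<in> omega_family V. 0 \<notin> W}"
      using V infinite_omega_family_missing_zero[of V] unfolding Omega_unit_def by blast+
    then obtain \<V> :: "nat \<Rightarrow> 'a set set"
      where \<V>: "\<And>n. finite (omega_family V - \<V> n)" "(\<Union>n. \<V> n) \<in> open_gamma_covers"
      using S[unfolded S_cof_def, rule_format, of "\<lambda>_. omega_family V"] by auto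
    have "finite {W \<in> \<Union>n. \<V> n. 0 \<notin> W}"
      using \<V>(2) unfolding open_gamma_covers_def gamma_cover_def by blast
    moreover have "{W \<in> omega_family V. 0 \<notin> W}
        \<subseteq> (omega_family V - \<V> 0) \<union> {W \<in> \<Union>n. \<V> n. 0 \<notin> W}"
      by blast
    ultimately show False
      using inf \<V>(1)[of 0] by (meson finite_UnI finite_subset)
  qed
qed

end
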